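(* Let $X$ be a separable Banach space. Then $ST(X)\le C(X)$. More precisely, if $ST(X,\delta)>\alpha$, for $\delta>0$ and $\alpha<\omega_1$, then $C(X,\delta)>\alpha$.
   Context: All Banach spaces are real; $B_X$ is the closed unit ball. $\omega=\{0,1,2,\dots\}$, $\omega_1$ is the first uncountable ordinal. For every limit ordinal $\alpha<\omega_1$ fix once and for all an enumeration $(\beta_n)_{n\in\omega}$ of all ordinals less than $\alpha$. By convention $\alpha<\infty$ for every ordinal $\alpha$. For finite sequences $s,t$, $s\cdot t$ denotes their concatenation ($s$ followed by $t$); a single element $a$ (such as a pair $(0,n)$ or $(1,n)$) is identified with the one-term sequence consisting of $a$, and $a\cdot S=\{a\cdot t:t\in S\}$ for a set $S$ of finite sequences. **Index $ST$.** Sets $S_\alpha$ ($\alpha<\omega_1$) of finite sequences in $\{0,1\}\times\omega$ are defined by: $S_0=\{\varnothing\}$; $S_{\alpha+1}=\{\varnothing\}\cup\bigcup_{n\in\omega}\big((0,n)\cdot S_\alpha\cup(1,n)\cdot S_\alpha\big)$; for $\alpha$ limit, $S_\alpha=\{\varnothing\}\cup\bigcup_{n\in\omega}(0,n)\cdot S_{\beta_n}$. Every $s\in S_\alpha$ is of one of three types: (A) $s$ has no successor in $S_\alpha$; (B) its successors are all $s\cdot(0,n)$ and all $s\cdot(1,n)$, $n\in\omega$; (C) its successors are exactly all $s\cdot(0,n)$, $n\in\omega$. For $\delta>0$, a $\delta$-$\alpha$-sprawling tree in $X$ is a family $(x_s)_{s\in S_\alpha}\subset X$ such that: if $s$ is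 of type (B), then $x_s=\frac12(x_{s\cdot(0,n)}+x_{s\cdot(1,n)})$ for all $n\in\omega$ and $\|x_{s\cdot(0,n)}-x_{s\cdot(0,m)}\|\ge\delta$ for all $n\ne m$; if $s$ is of type (C), then $x_s=x_{s\cdot(0,n)}$ for all $n\in\omega$. $ST(X,\delta)=\inf\{\alpha<\omega_1: B_X\text{ does not contain a }\delta\text{-}\alpha\text{-sprawling tree}\}$ if this set is nonempty, and $ST(X,\delta)=\infty$ otherwise; $ST(X)=\sup_{\delta>0}ST(X,\delta)$. **Index $C$.** For $C\subset X$ and $\varepsilon>0$ let $\sigma_\varepsilon^1(C)=C\setminus\bigcup\{V: V\text{ weakly open in }X,\ \operatorname{diam}(V\cap C)<\varepsilon\}$. For a closed bounded convex set $C\subset X$ let $\gamma_\varepsilon^1(C)$ be the closed convex hull of $\sigma_\varepsilon^1(C)$, $\gamma_\varepsilon^0(C)=C$, $\gamma_\varepsilon^{\alpha+1}(C)=\gamma_\varepsilon^1(\gamma_\varepsilon^\alpha(C))$, and $\gamma_\varepsilon^\alpha(C)=\bigcap_{\beta<\alpha}\gamma_\varepsilon^\beta(C)$ for $\alpha$ limit. $C(X,\varepsilon)=\inf\{\alpha:\gamma_\varepsilon^\alpha(B_X)=\emptyset\}$ (with $\inf\emptyset=\infty$) and $C(X)=\sup_{\varepsilon>0}C(X,\varepsilon)$. *)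

theory Defs
  imports "HOL-Analysis.Analysis"
begin

section \<open>Ordinals\<close>

text \<open>
  HOL has no type of all ordinals.  For a type \<open>'a\<close> we use the ordinals below the initial ordinal
  of cardinality \<open>\<kappa> = |Pow (Pow ('a + nat))|\<close>: the type below is \<open>\<kappa>\<close> itself, since the library's
  \<^const>\<open>card_of\<close> is a well-order of minimal order type.  This is large enough for both indices of a
  Banach space \<open>'a\<close>: \<open>\<kappa>\<close> exceeds \<open>\<omega>\<^sub>1\<close> and also the cardinal successor of \<open>|'a|\<close>, while the
  iterated derivation of a closed convex subset of \<open>'a\<close> removes a point at every step until it becomes stationary,
  so if it reaches the empty set then it does so at an ordinal of cardinality at most \<open>|'a|\<close>.
\<close>

typedef 'a ordinal = "UNIV :: ('a + nat) set set set" by simp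

instantiation ordinal :: (type) wellorder
begin

definition less_eq_ordinal :: "'a ordinal \<Rightarrow> 'a ordinal \<Rightarrow> bool" where
  "a \<le> b \<longleftrightarrow> (Rep_ordinal a, Rep_ordinal b) \<in> card_of (UNIV :: ('a + nat) set set set)"

definition less_ordinal :: "'a ordinal \<Rightarrow> 'a ordinal \<Rightarrow> bool" where
  "less_ordinal a b \<longleftrightarrow> a \<le> b \<and> a \<noteq> b"

instance
proof
  let ?r = "card_of (UNIV :: ('a + nat) set set set)"
  have wo: "Well_order ?r" by (rule card_of_Well_order)
  have F: "Field ?r = UNIV" by (rule Field_card_of)
  interpret wo_rel ?r using wo by (simp add: wo_rel_def)
  have R: "(x, x) \<in> ?r" for x using REFL F by (auto simp: refl_on_def)
  fix x y z :: "'a ordinal"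
  show asym: "x \<le> y \<Longrightarrow> y \<le> x \<Longrightarrow> x = y" for x y :: "'a ordinal"
    using ANTISYM by (metis antisymD less_eq_ordinal_def Rep_ordinal_inject)
  show "x < y \<longleftrightarrow> x \<le> y \<and> \<not> y \<le> x"
    using asym R by (auto simp: less_ordinal_def less_eq_ordinal_def)
  show "x \<le> x" using R by (simp add: less_eq_ordinal_def)
  show "x \<le> y \<Longrightarrow> y \<le> z \<Longrightarrow> x \<le> z"
    using TRANS by (auto simp: less_eq_ordinal_def dest: transD)
  show "x \<le> y \<or> y \<le> x"
    using TOTALS F by (auto simp: less_eq_ordinal_def)
  fix P and a :: "'a ordinal"
  assume step: "\<And>x::'a ordinal. (\<And>y. y < x \<Longrightarrow> P y) \<Longrightarrow> P x"
  have "P (Abs_ordinal u)" for u :: "('a + nat) set set"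
  proof (induction u rule: wf_induct_rule[OF WF])
    case (1 u)
    show ?case
    proof (rule step)
      fix y :: "'a ordinal" assume "y < Abs_ordinal u"
      then have "(Rep_ordinal y, u) \<in> ?r - Id"
        by (auto simp: less_ordinal_def less_eq_ordinal_def Abs_ordinal_inverse
            Rep_ordinal_inverse)
      then have "P (Abs_ordinal (Rep_ordinal y))" by (rule 1)
      then show "P y" by (simp add: Rep_ordinal_inverse)
    qed
  qed
  then show "P a" by (metis Rep_ordinal_inverse)
qed

end

instantiation ordinal :: (type) zero
begin

definition zero_ordinal :: "'a ordinal" where "zero_ordinal = (LEAST a. True)"

instance ..

end

definition osucc :: "'a ordinal \<Rightarrow> 'a ordinal" where
  "osucc a = (LEAST b. a < b)"

definition is_limit :: "'a ordinal \<Rightarrow> bool" where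
  "is_limit a \<longleftrightarrow> a \<noteq> 0 \<and> (\<nexists>b. a = osucc b)"

definition omega1 :: "'a ordinal" where
  "omega1 = (LEAST a. uncountable {..<a})"

lemma ordinal_zero_le [simp]: "0 \<le> (a :: 'a ordinal)"
  unfolding zero_ordinal_def by (rule Least_le) simp

lemma ordinal_not_less_zero [simp]: "\<not> (a :: 'a ordinal) < 0"
  by (simp add: not_less)

text \<open>Every well-order of order type less than \<open>\<kappa>\<close> is a proper initial segment of
  \<^typ>\<open>'a ordinal\<close>.\<close>

lemma well_order_iso_initial_segment:
  fixes r :: "'b rel"
  assumes r: "Well_order r"
    and less: "(r, card_of (UNIV :: ('a + nat) set set set)) \<in> ordLess"
  shows "\<exists>(a :: 'a ordinal) f. bij_betw f (Field r) {..<a} \<and>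
           (\<forall>x\<in>Field r. \<forall>y\<in>Field r. (x, y) \<in> r \<longleftrightarrow> f x \<le> f y)"
proof -
  let ?k = "card_of (UNIV :: ('a + nat) set set set)"
  have wo: "Well_order ?k" by (rule card_of_Well_order)
  obtain u where u: "(r, Restr ?k (underS ?k u)) \<in> ordIso"
    using less unfolding ordLess_iff_ordIso_Restr[OF wo r] by (rule bexE)
  obtain g where g: "iso r (Restr ?k (underS ?k u)) g"
    using u by (auto simp: ordIso_def)
  have "wo_rel.ofilter ?k (underS ?k u)"
    using wo by (intro wo_rel.underS_ofilter) (simp add: wo_rel_def)
  then have "Field (Restr ?k (underS ?k u)) = underS ?k u"
    by (rule Field_Restr_ofilter[OF wo])
  then have bij: "bij_betw g (Field r) (underS ?k u)"
    using g by (simp add: iso_def)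
  let ?a = "Abs_ordinal u :: 'a ordinal"
  have seg: "Abs_ordinal ` underS ?k u = {..<?a}"
  proof (rule set_eqI)
    fix y :: "'a ordinal"
    obtain v where y: "y = Abs_ordinal v" by (metis Rep_ordinal_inverse)
    show "y \<in> Abs_ordinal ` underS ?k u \<longleftrightarrow> y \<in> {..<?a}"
      by (auto simp: y underS_def less_ordinal_def less_eq_ordinal_def Abs_ordinal_inverse
          Abs_ordinal_inject)
  qed
  have "bij_betw (Abs_ordinal :: _ \<Rightarrow> 'a ordinal) (underS ?k u) {..<?a}"
    unfolding bij_betw_def using seg by (auto simp: inj_on_def Abs_ordinal_inject)
  then have 1: "bij_betw (Abs_ordinal \<circ> g) (Field r) {..<?a}"
    using bij by (rule bij_betw_trans[rotated])
  have 2: "(x, y) \<in> r \<longleftrightarrow> (Abs_ordinal (g x) :: 'a ordinal) \<le> Abs_ordinal (g y)"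
    if "x \<in> Field r" "y \<in> Field r" for x y
  proof -
    have "(x, y) \<in> r \<longleftrightarrow> (g x, g y) \<in> Restr ?k (underS ?k u)"
      using g that by (simp only: iso_iff2)
    also have "\<dots> \<longleftrightarrow> (g x, g y) \<in> ?k"
      using bij that by (auto simp: bij_betw_def)
    finally show ?thesis by (simp add: less_eq_ordinal_def Abs_ordinal_inverse)
  qed
  show ?thesis using 1 2 by (intro exI[of _ ?a] exI[of _ "Abs_ordinal \<circ> g"]) auto
qed

lemma less_osucc [simp]: "a < osucc a"
proof -
  let ?k = "card_of (UNIV :: ('a + nat) set set set)"
  have "infinite (UNIV :: ('a + nat) set set set)"
    by (simp add: Finite_Set.finite_set)
  then obtain v where v: "Rep_ordinal a \<noteq> v" "(Rep_ordinal a, v) \<in> ?k"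
    using infinite_Card_order_limit[of ?k "Rep_ordinal a"] card_of_Card_order
    by (auto simp: Field_card_of)
  then have "a < Abs_ordinal v"
    by (auto simp: less_ordinal_def less_eq_ordinal_def Abs_ordinal_inverse)
  then show ?thesis unfolding osucc_def by (rule LeastI)
qed

lemma osucc_le_iff: "osucc a \<le> b \<longleftrightarrow> a < b"
  using less_osucc[of a] by (auto simp: osucc_def intro: Least_le less_le_trans)

lemma osucc_inject [simp]: "osucc a = osucc b \<longleftrightarrow> a = b"
  by (metis less_osucc linorder_neqE not_less osucc_le_iff)

lemma osucc_neq_zero [simp]: "osucc a \<noteq> 0"
  by (metis less_osucc ordinal_not_less_zero)

lemma not_is_limit_osucc [simp]: "\<not> is_limit (osucc a)"
  by (auto simp: is_limit_def)

lemma not_is_limit_zero [simp]: "\<not> is_limit 0"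
  by (auto simp: is_limit_def)

lemma uncountable_lessThan_omega1: "uncountable {..<omega1 :: 'a ordinal}"
proof -
  let ?w = "cardSuc natLeq"
  let ?k = "card_of (UNIV :: ('a + nat) set set set)"
  have card: "Card_order natLeq" "Card_order ?w"
    by (simp_all add: natLeq_Card_order cardSuc_Card_order)
  have inj: "inj_on (Inr :: nat \<Rightarrow> 'a + nat) UNIV"
    by (auto simp: inj_on_def)
  have "(card_of (UNIV :: nat set), card_of (UNIV :: ('a + nat) set)) \<in> ordLeq"
    using inj card_of_ordLeq[of "UNIV :: nat set" "UNIV :: ('a + nat) set"] by blast
  then have "(natLeq, card_of (UNIV :: ('a + nat) set)) \<in> ordLeq"
    using card_of_nat ordIso_symmetric ordIso_ordLeq_trans by blast
  moreover have "(card_of (UNIV :: ('a + nat) set), card_of (UNIV :: ('a + nat) set set)) \<in> ordLess"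
    using card_of_Pow[of "UNIV :: ('a + nat) set"] by (simp add: Pow_UNIV)
  ultimately have "(natLeq, card_of (UNIV :: ('a + nat) set set)) \<in> ordLess"
    by (rule ordLeq_ordLess_trans)
  then have "(?w, card_of (UNIV :: ('a + nat) set set)) \<in> ordLeq"
    by (intro cardSuc_least card card_of_Card_order)
  moreover have "(card_of (UNIV :: ('a + nat) set set), ?k) \<in> ordLess"
    using card_of_Pow[of "UNIV :: ('a + nat) set set"] by (simp add: Pow_UNIV)
  ultimately have "(?w, ?k) \<in> ordLess"
    by (rule ordLeq_ordLess_trans)
  then obtain a :: "'a ordinal" and f where f: "bij_betw f (Field ?w) {..<a}"
    using well_order_iso_initial_segment[of ?w] card
    by (metis card_order_on_well_order_on)
  have "uncountable (Field ?w)"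
  proof
    assume "countable (Field ?w)"
    then have "(card_of (Field ?w), card_of (UNIV :: nat set)) \<in> ordLeq"
      unfolding countable_def by (subst card_of_ordLeq[symmetric]) auto
    then have "(?w, natLeq) \<in> ordLeq"
      using card(2) card_of_Field_ordIso card_of_nat ordIso_ordLeq_trans ordIso_symmetric
        ordLeq_ordIso_trans by metis
    then show False
      using cardSuc_greater[OF card(1)] not_ordLess_ordLeq by blast
  qed
  then have "uncountable {..<a}"
    using f countable_image_inj_on[of f "Field ?w"] by (auto simp: bij_betw_def)
  then show ?thesis unfolding omega1_def by (rule LeastI)
qed

lemma less_omega1_iff: "a < omega1 \<longleftrightarrow> countable {..<a}"
proof
  show "a < omega1 \<Longrightarrow> countable {..<a}"
    unfolding omega1_def using not_less_Least by blast
  assume a: "countable {..<a}"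
  show "a < omega1"
  proof (rule ccontr)
    assume "\<not> a < omega1"
    then have "{..<omega1} \<subseteq> {..<a}" by auto
    then show False
      using a uncountable_lessThan_omega1 countable_subset by blast
  qed
qed


section \<open>Ordinal indices, with a value \<open>\<infinity>\<close>\<close>

datatype 'o index = Ord 'o | Infty

instantiation index :: (wellorder) complete_linorder
begin

fun less_eq_index :: "'o::wellorder index \<Rightarrow> 'o index \<Rightarrow> bool" where
  "less_eq_index (Ord a) (Ord b) \<longleftrightarrow> a \<le> b"
| "less_eq_index Infty (Ord b) \<longleftrightarrow> False"
| "less_eq_index x Infty \<longleftrightarrow> True"

definition less_index :: "'o::wellorder index \<Rightarrow> 'o index \<Rightarrow> bool" where
  "less_index x y \<longleftrightarrow> x \<le> y \<and> \<not> y \<le> x"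

definition top_index :: "'o::wellorder index" where "top_index = Infty"

definition bot_index :: "'o::wellorder index" where "bot_index = Ord (LEAST a. True)"

definition inf_index :: "'o::wellorder index \<Rightarrow> 'o index \<Rightarrow> 'o index" where
  "inf_index x y = (if x \<le> y then x else y)"

definition sup_index :: "'o::wellorder index \<Rightarrow> 'o index \<Rightarrow> 'o index" where
  "sup_index x y = (if x \<le> y then y else x)"

definition Inf_index :: "'o::wellorder index set \<Rightarrow> 'o index" where
  "Inf_index A = (if \<exists>a. Ord a \<in> A then Ord (LEAST a. Ord a \<in> A) else Infty)"

definition Sup_index :: "'o::wellorder index set \<Rightarrow> 'o index" where
  "Sup_index A = Inf {u. \<forall>x\<in>A. x \<le> u}"

instance
proof
  fix x y z :: "('o::wellorder) index"
  show "x < y \<longleftrightarrow> x \<le> y \<and> \<not> y \<le> x" by (rule less_index_def)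
  show rf: "x \<le> x" for x :: "'o index" by (cases x) simp_all
  show "x \<le> y \<Longrightarrow> y \<le> z \<Longrightarrow> x \<le> z" by (cases x; cases y; cases z) simp_all
  show "x \<le> y \<Longrightarrow> y \<le> x \<Longrightarrow> x = y" by (cases x; cases y) simp_all
  show lin: "x \<le> y \<or> y \<le> x" for x y :: "'o index"
    by (cases x; cases y) (simp_all add: linear)
  show "inf x y \<le> x" "inf x y \<le> y" "x \<le> y \<Longrightarrow> x \<le> z \<Longrightarrow> x \<le> inf y z"
    unfolding inf_index_def using lin rf by auto
  show "x \<le> sup x y" "y \<le> sup x y" "y \<le> x \<Longrightarrow> z \<le> x \<Longrightarrow> sup y z \<le> x"
    unfolding sup_index_def using lin rf by auto
next
  have lower: "Inf A \<le> x" if "x \<in> A" for x :: "('o::wellorder) index" and A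
  proof (cases x)
    case (Ord a)
    with that have "(LEAST a. Ord a \<in> A) \<le> a" by (intro Least_le) simp
    with Ord that show ?thesis by (auto simp: Inf_index_def)
  next
    case Infty
    then show ?thesis by (cases "Inf A") simp_all
  qed
  have greatest: "z \<le> Inf A" if *: "\<And>x. x \<in> A \<Longrightarrow> z \<le> x" for z :: "('o::wellorder) index" and A
  proof (cases "\<exists>a. Ord a \<in> A")
    case True
    then have "Ord (LEAST a. Ord a \<in> A) \<in> A" by (rule LeastI_ex)
    then have "z \<le> Ord (LEAST a. Ord a \<in> A)" by (rule *)
    with True show ?thesis by (simp add: Inf_index_def)
  next
    case False
    then show ?thesis by (cases z) (simp_all add: Inf_index_def)
  qed
  fix x z :: "('o::wellorder) index" and A :: "('o::wellorder) index set"
  show "x \<in> A \<Longrightarrow> Inf A \<le> x" by (rule lower)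
  show "(\<And>x. x \<in> A \<Longrightarrow> z \<le> x) \<Longrightarrow> z \<le> Inf A" by (rule greatest)
  show "x \<in> A \<Longrightarrow> x \<le> Sup A"
    unfolding Sup_index_def by (rule greatest) simp
  show "(\<And>x. x \<in> A \<Longrightarrow> x \<le> z) \<Longrightarrow> Sup A \<le> z"
    unfolding Sup_index_def by (rule lower) simp
  show "Inf {} = (top :: ('o::wellorder) index)" by (simp add: Inf_index_def top_index_def)
  show "Sup {} = (bot :: ('o::wellorder) index)"
    unfolding Sup_index_def Inf_index_def bot_index_def by simp
qed

end

lemma Ord_less_iff [simp]: "Ord a < Ord b \<longleftrightarrow> a < b"
  by (auto simp: less_index_def)

lemma Ord_less_Infty [simp]: "Ord a < Infty"
  by (auto simp: less_index_def)


section \<open>Sprawling trees and the index \<open>ST\<close>\<close>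

text \<open>\<open>en a\<close> is the enumeration \<open>(\<beta>\<^sub>n)\<close> fixed for the countable limit ordinal \<open>a\<close>; repetitions are
  allowed.\<close>

definition limit_enumeration :: "('a ordinal \<Rightarrow> nat \<Rightarrow> 'a ordinal) \<Rightarrow> bool" where
  "limit_enumeration en \<longleftrightarrow> (\<forall>a. a < omega1 \<and> is_limit a \<longrightarrow> range (en a) = {..<a})"

lemma limit_enumeration_exists: "\<exists>en. limit_enumeration (en :: 'a ordinal \<Rightarrow> nat \<Rightarrow> 'a ordinal)"
proof (intro exI)
  show "limit_enumeration (\<lambda>a :: 'a ordinal. from_nat_into {..<a})"
    unfolding limit_enumeration_def
  proof (intro allI impI)
    fix a :: "'a ordinal" assume "a < omega1 \<and> is_limit a"
    then have "countable {..<a}" "a \<noteq> 0"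
      by (simp_all add: less_omega1_iff is_limit_def)
    moreover from this have "0 \<in> {..<a}"
      by (simp add: less_le)
    ultimately show "range (from_nat_into {..<a}) = {..<a}"
      by (intro range_from_nat_into) auto
  qed
qed

text \<open>The recursion defining \<open>S\<^sub>\<alpha>\<close>, in inductive form; the recursion equations are derived below.\<close>

inductive in_S :: "('a ordinal \<Rightarrow> nat \<Rightarrow> 'a ordinal) \<Rightarrow> 'a ordinal \<Rightarrow> (nat \<times> nat) list \<Rightarrow> bool"
  for en where
  empty: "in_S en a []"
| succ: "in_S en a t \<Longrightarrow> i \<in> {0, 1} \<Longrightarrow> in_S en (osucc a) ((i, n) # t)"
| limit: "is_limit a \<Longrightarrow> in_S en (en a n) t \<Longrightarrow> in_S en a ((0, n) # t)"

definition S_set :: "('a ordinal \<Rightarrow> nat \<Rightarrow> 'a ordinal) \<Rightarrow> 'a ordinal \<Rightarrow> (nat \<times> nat) list set" where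
  "S_set en a = {s. in_S en a s}"

lemma S_set_zero: "S_set en 0 = {[]}"
  unfolding S_set_def by (auto intro: in_S.empty elim: in_S.cases)

lemma S_set_osucc: "S_set en (osucc a) = {[]} \<union> (\<Union>n. (#) (0, n) ` S_set en a \<union> (#) (1, n) ` S_set en a)"
  (is "_ = ?R")
proof
  have "s \<in> ?R" if "in_S en (osucc a) s" for s
    using that by (cases rule: in_S.cases) (auto simp: S_set_def)
  then show "S_set en (osucc a) \<subseteq> ?R" by (auto simp: S_set_def)
  show "?R \<subseteq> S_set en (osucc a)" by (auto simp: S_set_def intro: in_S.intros)
qed

lemma S_set_limit:
  assumes "is_limit a"
  shows "S_set en a = {[]} \<union> (\<Union>n. (#) (0, n) ` S_set en (en a n))" (is "_ = ?R")
proof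
  have "s \<in> ?R" if "in_S en a s" for s
    using that assms by (cases rule: in_S.cases) (auto simp: S_set_def)
  then show "S_set en a \<subseteq> ?R" by (auto simp: S_set_def)
  show "?R \<subseteq> S_set en a" using assms by (auto simp: S_set_def intro: in_S.intros)
qed

definition successors :: "(nat \<times> nat) list set \<Rightarrow> (nat \<times> nat) list \<Rightarrow> (nat \<times> nat) list set" where
  "successors T s = {t \<in> T. \<exists>p. t = s @ [p]}"

definition typeB :: "(nat \<times> nat) list set \<Rightarrow> (nat \<times> nat) list \<Rightarrow> bool" where
  "typeB T s \<longleftrightarrow> successors T s = range (\<lambda>n. s @ [(0, n)]) \<union> range (\<lambda>n. s @ [(1, n)])"

definition typeC :: "(nat \<times> nat) list set \<Rightarrow> (nat \<times> nat) list \<Rightarrow> bool" where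
  "typeC T s \<longleftrightarrow> successors T s = range (\<lambda>n. s @ [(0, n)])"

definition sprawling_tree ::
  "('a ordinal \<Rightarrow> nat \<Rightarrow> 'a ordinal) \<Rightarrow> real \<Rightarrow> 'a ordinal \<Rightarrow> ((nat \<times> nat) list \<Rightarrow> 'a::banach) \<Rightarrow> bool"
  where
  "sprawling_tree en \<delta> a x \<longleftrightarrow>
     (\<forall>s \<in> S_set en a.
        (typeB (S_set en a) s \<longrightarrow>
           (\<forall>n. x s = (1/2) *\<^sub>R (x (s @ [(0, n)]) + x (s @ [(1, n)]))) \<and>
           (\<forall>n m. n \<noteq> m \<longrightarrow> norm (x (s @ [(0, n)]) - x (s @ [(0, m)])) \<ge> \<delta>)) \<and>
        (typeC (S_set en a) s \<longrightarrow> (\<forall>n. x s = x (s @ [(0, n)]))))"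

definition contains_sprawling_tree ::
  "('a::banach ordinal \<Rightarrow> nat \<Rightarrow> 'a ordinal) \<Rightarrow> real \<Rightarrow> 'a ordinal \<Rightarrow> 'a set \<Rightarrow> bool" where
  "contains_sprawling_tree en \<delta> a B \<longleftrightarrow> (\<exists>x. sprawling_tree en \<delta> a x \<and> x ` S_set en a \<subseteq> B)"

text \<open>The space is the type \<open>'a\<close>, which is determined by the type of the index.\<close>

definition ST_at :: "('a::banach ordinal \<Rightarrow> nat \<Rightarrow> 'a ordinal) \<Rightarrow> real \<Rightarrow> 'a ordinal index" where
  "ST_at en \<delta> = Inf {Ord a |a. a < omega1 \<and> \<not> contains_sprawling_tree en \<delta> a (cball 0 1)}"

definition ST_index :: "('a::banach ordinal \<Rightarrow> nat \<Rightarrow> 'a ordinal) \<Rightarrow> 'a ordinal index" where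
  "ST_index en = (SUP \<delta>\<in>{0<..}. ST_at en \<delta>)"


section \<open>The convex derivation \<open>\<gamma>\<close> and the index \<open>C\<close>\<close>

definition weak_topology :: "'a::real_normed_vector topology" where
  "weak_topology =
     topology_generated_by {f -` U |(f :: 'a \<Rightarrow> real) U. bounded_linear f \<and> open U}"

text \<open>\<^const>\<open>diameter\<close> is meaningful for bounded sets only, hence the explicit boundedness.\<close>

definition sigma1 :: "real \<Rightarrow> 'a::banach set \<Rightarrow> 'a set" where
  "sigma1 \<epsilon> K =
     K - \<Union>{V. openin weak_topology V \<and> bounded (V \<inter> K) \<and> diameter (V \<inter> K) < \<epsilon>}"

definition gamma1 :: "real \<Rightarrow> 'a::banach set \<Rightarrow> 'a set" where
  "gamma1 \<epsilon> K = closure (convex hull (sigma1 \<epsilon> K))"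

function gamma :: "real \<Rightarrow> 'a ordinal \<Rightarrow> 'a::banach set \<Rightarrow> 'a set" where
  "gamma \<epsilon> a K =
     (if a = 0 then K
      else if is_limit a then \<Inter>b\<in>{..<a}. gamma \<epsilon> b K
      else gamma1 \<epsilon> (gamma \<epsilon> (THE b. a = osucc b) K))"
  by pat_completeness auto
termination
proof (relation "inv_image {(x, y). x < y} (\<lambda>(\<epsilon>, a, K). a)")
  show "wf (inv_image {(x, y). x < y} (\<lambda>(\<epsilon> :: real, a :: 'a ordinal, K :: 'a set). a))"
    by (intro wf_inv_image wf)
next
  fix \<epsilon> :: real and a :: "'a ordinal" and K :: "'a set"
  assume "a \<noteq> 0" "\<not> is_limit a"
  then obtain b where "a = osucc b" by (auto simp: is_limit_def)
  then have "(THE b. a = osucc b) < a" by simp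
  then show "((\<epsilon>, THE b. a = osucc b, K), \<epsilon>, a, K)
      \<in> inv_image {(x, y). x < y} (\<lambda>(\<epsilon>, a, K). a)" by simp
qed auto

declare gamma.simps [simp del]

lemma gamma_zero: "gamma \<epsilon> 0 K = K"
  by (subst gamma.simps) simp

lemma gamma_osucc: "gamma \<epsilon> (osucc a) K = gamma1 \<epsilon> (gamma \<epsilon> a K)"
  by (subst gamma.simps) simp

lemma gamma_limit: "is_limit a \<Longrightarrow> gamma \<epsilon> a K = (\<Inter>b\<in>{..<a}. gamma \<epsilon> b K)"
  by (subst gamma.simps) auto

definition C_at :: "real \<Rightarrow> 'a::banach ordinal index" where
  "C_at \<epsilon> = Inf {Ord a |a. gamma \<epsilon> a (cball 0 1 :: 'a set) = {}}"

definition C_index :: "'a::banach ordinal index" where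
  "C_index = (SUP \<epsilon>\<in>{0<..}. C_at \<epsilon>)"

end

theory Submission
  imports Defs
begin

text \<open>
  The root of a sprawling tree of height \<open>\<alpha>\<close> in a bounded convex set \<open>K\<close> lies in \<open>\<gamma>\<^sup>\<alpha>(K)\<close>.  This goes
  by induction on \<open>\<alpha>\<close>, the nodes of length one being roots of shorter trees.  At a limit ordinal the root
  equals those nodes, one in each \<open>\<gamma>\<^sup>\<beta>(K)\<close> with \<open>\<beta> < \<alpha>\<close>.  At a successor \<open>\<beta> + 1\<close> the
  root \<open>x\<close> is the midpoint of \<open>y\<^sub>n\<close> and \<open>z\<^sub>n\<close> for every \<open>n\<close>, where all these points lie in the convex set
  \<open>L = \<gamma>\<^sup>\<beta>(K)\<close> and the \<open>y\<^sub>n\<close> are \<open>\<delta>\<close>-separated.  Then \<open>x\<close> is not removed from \<open>L\<close>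
  (\<open>sprawling_midpoint_in_sigma1\<close>): by convexity \<open>L\<close> contains the midpoint
  \<open>x + (y\<^sub>n - y\<^sub>m)/2\<close> of \<open>y\<^sub>n\<close> and \<open>z\<^sub>m\<close>, and likewise \<open>x - (y\<^sub>n - y\<^sub>m)/2\<close>.  These two points are at
  distance at least \<open>\<delta>\<close>, and for suitable \<open>n \<noteq> m\<close> both lie in a given weak neighbourhood of \<open>x\<close>, because a
  weak neighbourhood restrains only finitely many functionals, and along some subsequence of a bounded
  sequence all of these take nearly constant values (\<open>weak_nhd_absorbs_half_differences\<close>).

  Hence \<open>\<gamma>\<^sup>\<alpha>\<close> of the unit ball is nonempty for every countable \<open>\<alpha>\<close> below the tree index, which gives
  \<open>ST(X,\<delta>) \<le> C(X,\<delta>)\<close> except when \<open>C(X,\<delta>)\<close> is an uncountable ordinal and \<open>ST(X,\<delta>) = \<infinity>\<close>.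
  Separability rules this out: a decreasing family of closed sets in a second countable space is
  stationary from some countable ordinal on, so \<open>C(X,\<delta>)\<close> is either a countable ordinal or \<open>\<infinity>\<close>.
\<close>

section \<open>Weak neighbourhoods and bounded sequences\<close>

text \<open>The sets with this property, for all their points \<open>x\<close> and all bounded sequences \<open>u\<close>, are closed
  under finite intersections (pass to a subsequence of a subsequence) and unions, and they include the
  preimages of open sets under functionals \<open>f\<close>, since the bounded real sequence \<open>f \<circ> u\<close> has a
  convergent subsequence.  The whole subsequence is provided, rather than one pair of indices, so that
  the induction goes through intersections.\<close>

lemma weak_nhd_absorbs_half_differences:
  fixes u :: "nat \<Rightarrow> 'a::real_normed_vector"
  assumes V: "openin weak_topology V" and x: "x \<in> V" and u: "bounded (range u)"
  shows "\<exists>r. strict_mono (r :: nat \<Rightarrow> nat) \<and> (\<forall>n m. x + (1/2) *\<^sub>R (u (r n) - u (r m)) \<in> V)"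
proof -
  let ?sub = "{f -` U |(f :: 'a \<Rightarrow> real) U. bounded_linear f \<and> open U}"
  have "generate_topology_on ?sub V"
    using V by (simp add: weak_topology_def openin_topology_generated_by_iff)
  then show ?thesis using x u
  proof (induction arbitrary: x u rule: generate_topology_on.induct)
    case Empty
    then show ?case by simp
  next
    case (Int V W)
    obtain r :: "nat \<Rightarrow> nat" where r: "strict_mono r"
      and rV: "\<And>n m. x + (1/2) *\<^sub>R (u (r n) - u (r m)) \<in> V"
      using Int by blast
    have "bounded (range (u \<circ> r))"
      using Int.prems(2) by (rule bounded_subset) auto
    then obtain q :: "nat \<Rightarrow> nat" where q: "strict_mono q"
      and qW: "\<And>n m. x + (1/2) *\<^sub>R ((u \<circ> r) (q n) - (u \<circ> r) (q m)) \<in> W"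
      using Int.IH(2)[of x "u \<circ> r"] Int.prems(1) by blast
    have "strict_mono (r \<circ> q)"
      using r q by (rule strict_mono_o)
    then show ?case
      using rV qW by (intro exI[of _ "r \<circ> q"] conjI) (simp_all add: o_def)
  next
    case (UN K)
    then show ?case by (meson UnionE UnionI)
  next
    case (Basis W)
    then obtain f :: "'a \<Rightarrow> real" and U where W: "W = f -` U" and f: "bounded_linear f" and U: "open U"
      by blast
    interpret f: bounded_linear f by (rule f)
    obtain e where e: "e > 0" and eU: "ball (f x) e \<subseteq> U"
      using U Basis.prems(1) W by (auto simp: open_contains_ball)
    have "bounded (range (f \<circ> u))"
      using bounded_linear_image[OF Basis.prems(2) f] by (simp add: image_comp)
    then obtain l and r :: "nat \<Rightarrow> nat" where r: "strict_mono r" and l: "(f \<circ> u \<circ> r) \<longlonglongrightarrow> l"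
      using bounded_imp_convergent_subsequence by blast
    obtain N where N: "\<And>n. n \<ge> N \<Longrightarrow> dist (f (u (r n))) l < e"
      using metric_LIMSEQ_D[OF l e] by auto
    have "x + (1/2) *\<^sub>R (u (r (n + N)) - u (r (m + N))) \<in> W" for n m
    proof -
      have eq: "f (x + (1/2) *\<^sub>R (u (r (n + N)) - u (r (m + N)))) =
          f x + (f (u (r (n + N))) - f (u (r (m + N)))) / 2"
        by (simp add: f.add f.scaleR f.diff)
      have "dist (f x) (f (x + (1/2) *\<^sub>R (u (r (n + N)) - u (r (m + N))))) < e"
        using N[OF le_add2, of n] N[OF le_add2, of m] unfolding eq dist_real_def
        by (auto simp: abs_less_iff field_simps)
      then show ?thesis using eU W by auto
    qed
    moreover have "strict_mono (\<lambda>n. r (n + N))"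
      using r by (simp add: strict_mono_def)
    ultimately show ?case by blast
  qed
qed

section \<open>The convex derivation\<close>

text \<open>Convexity mixes the two sequences: \<open>x + (y\<^sub>n - y\<^sub>m)/2\<close> is the midpoint of \<open>y\<^sub>n\<close> and \<open>z\<^sub>m\<close>.  So \<open>x\<close> is
  also the midpoint of segments in \<open>K\<close> with direction \<open>y\<^sub>n - y\<^sub>m\<close>, and these differences, unlike the
  directions \<open>y\<^sub>n - z\<^sub>n\<close> of the given segments, can be chosen weakly small although their norms are at
  least \<open>\<delta>\<close>.\<close>

lemma sprawling_midpoint_in_sigma1:
  fixes y z :: "nat \<Rightarrow> 'a::banach"
  assumes K: "convex K" and y: "range y \<subseteq> K" and z: "range z \<subseteq> K" and "bounded (range y)"
    and mid: "\<And>n. x = (1/2) *\<^sub>R (y n + z n)"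
    and sep: "\<And>n m. n \<noteq> m \<Longrightarrow> norm (y n - y m) \<ge> \<delta>"
  shows "x \<in> sigma1 \<delta> K"
proof -
  have cross: "x + (1/2) *\<^sub>R (y n - y m) \<in> K" for n m
  proof -
    have "x + (1/2) *\<^sub>R (y n - y m) = (1/2) *\<^sub>R y n + (1/2) *\<^sub>R z m"
      by (subst mid[of m]) (simp add: algebra_simps)
    also have "\<dots> \<in> K"
      using K y z by (intro convexD) auto
    finally show ?thesis .
  qed
  have "x \<in> K" using cross[of 0 0] by simp
  moreover have "\<not> diameter (V \<inter> K) < \<delta>"
    if V: "openin weak_topology V" "x \<in> V" and bd: "bounded (V \<inter> K)" for V
  proof -
    obtain r :: "nat \<Rightarrow> nat" where r: "strict_mono r"
      and rV: "\<And>n m. x + (1/2) *\<^sub>R (y (r n) - y (r m)) \<in> V"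
      using weak_nhd_absorbs_half_differences[OF V \<open>bounded (range y)\<close>] by blast
    let ?p = "x + (1/2) *\<^sub>R (y (r 0) - y (r 1))" and ?q = "x + (1/2) *\<^sub>R (y (r 1) - y (r 0))"
    have "dist ?p ?q \<le> diameter (V \<inter> K)"
      using bd rV cross by (intro diameter_bounded_bound) auto
    moreover have "?p - ?q = y (r 0) - y (r 1)"
      by (simp add: algebra_simps flip: scaleR_add_left)
    moreover have "r 0 \<noteq> r 1" using r by (simp add: strict_mono_eq)
    ultimately show ?thesis using sep[of "r 0" "r 1"] by (simp add: dist_norm)
  qed
  ultimately show ?thesis by (auto simp: sigma1_def)
qed

lemma sigma1_subset_gamma1: "sigma1 \<epsilon> K \<subseteq> gamma1 \<epsilon> K"
  unfolding gamma1_def by (meson closure_subset hull_subset subset_trans)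

lemma gamma1_mono: "gamma1 \<epsilon> K \<subseteq> gamma1 \<epsilon> L" if "K \<subseteq> L"
proof -
  have "bounded (V \<inter> K) \<and> diameter (V \<inter> K) < \<epsilon>"
    if "bounded (V \<inter> L)" "diameter (V \<inter> L) < \<epsilon>" for V
    using that \<open>K \<subseteq> L\<close> diameter_subset[of "V \<inter> K" "V \<inter> L"] bounded_subset[of "V \<inter> L" "V \<inter> K"]
    by force
  then have "sigma1 \<epsilon> K \<subseteq> sigma1 \<epsilon> L"
    using \<open>K \<subseteq> L\<close> unfolding sigma1_def by blast
  then show ?thesis
    unfolding gamma1_def by (intro closure_mono hull_mono)
qed

lemma gamma1_subset: "gamma1 \<epsilon> K \<subseteq> K" if "closed K" "convex K"
  unfolding gamma1_def using that
  by (intro closure_minimal hull_minimal) (auto simp: sigma1_def)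

lemma ordinal_cases [case_names zero osucc limit]:
  fixes a :: "'a ordinal"
  obtains "a = 0" | b where "a = osucc b" | "is_limit a"
  by (auto simp: is_limit_def)

lemma closed_gamma: "closed (gamma \<epsilon> a K)" if "closed K"
proof (induction a rule: less_induct)
  case (less a)
  then show ?case
    using that by (cases a rule: ordinal_cases) (auto simp: gamma_zero gamma_osucc gamma_limit gamma1_def)
qed

lemma convex_gamma: "convex (gamma \<epsilon> a K)" if "convex K"
proof (induction a rule: less_induct)
  case (less a)
  then show ?case
    using that by (cases a rule: ordinal_cases)
      (auto simp: gamma_zero gamma_osucc gamma_limit gamma1_def convex_closure convex_convex_hull
        intro!: convex_INT)
qed

lemma gamma_antimono:
  assumes K: "closed K" "convex K" and "a \<le> b"
  shows "gamma \<epsilon> b K \<subseteq> gamma \<epsilon> a K"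
  using \<open>a \<le> b\<close>
proof (induction b rule: less_induct)
  case (less b)
  show ?case
  proof (cases b rule: ordinal_cases)
    case zero
    then have "a = b" using less.prems by (simp add: order.antisym)
    then show ?thesis by simp
  next
    case (osucc c)
    show ?thesis
    proof (cases "a = b")
      case False
      then have "a \<le> c"
        using less.prems osucc by (metis osucc_le_iff not_le order.antisym)
      then have "gamma \<epsilon> c K \<subseteq> gamma \<epsilon> a K"
        using less.IH osucc by simp
      moreover have "gamma \<epsilon> b K \<subseteq> gamma \<epsilon> c K"
        unfolding osucc gamma_osucc by (intro gamma1_subset closed_gamma convex_gamma K)
      ultimately show ?thesis by blast
    qed simp
  next
    case limit
    then show ?thesis
      using less.prems by (cases "a = b") (auto simp: gamma_limit)
  qed
qed

text \<open>The derivation is monotone in the set to which it is applied, so a subset of \<open>K\<close> that equals its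
  own derived set stays inside every stage.\<close>

lemma gamma_stationary_subset:
  assumes K: "closed K" "convex K" and fixed: "gamma \<epsilon> (osucc c) K = gamma \<epsilon> c K"
  shows "gamma \<epsilon> c K \<subseteq> gamma \<epsilon> a K"
proof (induction a rule: less_induct)
  case (less a)
  show ?case
  proof (cases a rule: ordinal_cases)
    case zero
    then show ?thesis using gamma_antimono[OF K, of 0 c] by simp
  next
    case (osucc b)
    then have "gamma1 \<epsilon> (gamma \<epsilon> c K) \<subseteq> gamma1 \<epsilon> (gamma \<epsilon> b K)"
      using less.IH by (intro gamma1_mono) simp
    then show ?thesis using fixed osucc by (simp add: gamma_osucc)
  next
    case limit
    then show ?thesis using less.IH by (auto simp: gamma_limit)
  qed
qed

lemma separable_metric_imp_second_countable:
  assumes "separable_space (euclidean :: 'a::metric_space topology)"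
  shows "second_countable (euclidean :: 'a topology)"
proof -
  obtain D :: "'a set" where "countable D" and D: "closure D = UNIV"
    using assms by (auto simp: separable_space_def)
  let ?\<B> = "(\<lambda>(d, q). ball d q) ` (D \<times> (\<rat> :: real set))"
  have "\<exists>V\<in>?\<B>. x \<in> V \<and> V \<subseteq> U" if U: "open U" "x \<in> U" for U x
  proof -
    obtain e where e: "e > 0" "ball x e \<subseteq> U"
      using U by (auto simp: open_contains_ball)
    obtain q where q: "q \<in> \<rat>" "e / 4 < q" "q < e / 2"
      using Rats_dense_in_real[of "e / 4" "e / 2"] e by auto
    obtain d where d: "d \<in> D" "dist d x < e / 4"
      using D e closure_approachable[of x D] by (metis UNIV_I zero_less_divide_iff zero_less_numeral)
    have "ball d q \<subseteq> ball x e"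
    proof
      fix y assume "y \<in> ball d q"
      then show "y \<in> ball x e"
        using d q dist_triangle[of x y d] by (simp add: dist_commute)
    qed
    moreover have "x \<in> ball d q"
      using d q by simp
    ultimately show ?thesis using d q e by blast
  qed
  then show ?thesis
    unfolding second_countable_def
    using \<open>countable D\<close> by (intro exI[of _ ?\<B>]) (auto intro!: countable_image countable_rat)
qed

text \<open>While the derivation strictly decreases, each step \<open>c\<close> is witnessed by a member of a countable base
  that meets \<open>\<gamma>\<^sup>c(K)\<close> but not the closed set \<open>\<gamma>\<^sup>c\<^sup>+\<^sup>1(K)\<close>.  Different steps have different
  witnesses, so there are only countably many such steps.\<close>

lemma gamma_stationary_below_omega1:
  fixes K :: "'a::banach set"
  assumes sep: "separable_space (euclidean :: 'a topology)" and K: "closed K" "convex K"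
  shows "\<exists>c<omega1. gamma \<epsilon> (osucc c) K = gamma \<epsilon> c K"
proof (rule ccontr)
  assume "\<not> ?thesis"
  then have neq: "gamma \<epsilon> (osucc c) K \<noteq> gamma \<epsilon> c K" if "c < omega1" for c :: "'a ordinal"
    using that by blast
  have "second_countable (euclidean :: 'a topology)"
    using sep by (rule separable_metric_imp_second_countable)
  then obtain \<B> :: "'a set set" where "countable \<B>" and \<B>: "\<And>U x. open U \<Longrightarrow> x \<in> U \<Longrightarrow> \<exists>B\<in>\<B>. x \<in> B \<and> B \<subseteq> U"
    unfolding second_countable_def by auto
  have "\<exists>B\<in>\<B>. B \<inter> gamma \<epsilon> c K \<noteq> {} \<and> B \<inter> gamma \<epsilon> (osucc c) K = {}"
    if c: "c < omega1" for c :: "'a ordinal"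
  proof -
    have "gamma \<epsilon> (osucc c) K \<subseteq> gamma \<epsilon> c K"
      by (rule gamma_antimono[OF K]) (simp add: less_imp_le)
    then obtain x where x: "x \<in> gamma \<epsilon> c K" "x \<notin> gamma \<epsilon> (osucc c) K"
      using neq[OF c] by blast
    then show ?thesis
      using \<B>[of "- gamma \<epsilon> (osucc c) K" x] closed_gamma[OF K(1)] by blast
  qed
  then obtain B where B: "\<And>c. c < omega1 \<Longrightarrow> B c \<in> \<B>"
    and meet: "\<And>c. c < omega1 \<Longrightarrow> B c \<inter> gamma \<epsilon> c K \<noteq> {}"
    and avoid: "\<And>c. c < omega1 \<Longrightarrow> B c \<inter> gamma \<epsilon> (osucc c) K = {}"
    by metis
  have "B c \<noteq> B d" if "c < d" "d < omega1" for c d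
    using meet[of d] avoid[of c] that gamma_antimono[OF K, of "osucc c" d \<epsilon>]
    by (fastforce simp: osucc_le_iff)
  then have "inj_on B {..<omega1}"
    by (intro inj_onI) (metis lessThan_iff linorder_neqE)
  moreover have "countable (B ` {..<omega1})"
    using \<open>countable \<B>\<close> B by (auto intro: countable_subset)
  ultimately show False
    using uncountable_lessThan_omega1 countable_image_inj_on by blast
qed

lemma gamma_nonempty_if_nonempty_below_omega1:
  fixes K :: "'a::banach set"
  assumes "separable_space (euclidean :: 'a topology)" and "closed K" "convex K"
    and "\<And>c. c < omega1 \<Longrightarrow> gamma \<epsilon> c K \<noteq> {}"
  shows "gamma \<epsilon> a K \<noteq> {}"
  using assms gamma_stationary_below_omega1[of K \<epsilon>] gamma_stationary_subset[of K \<epsilon> _ a] by blast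

section \<open>Roots of sprawling trees\<close>

lemma in_S_osucc_Cons_iff: "in_S en (osucc a) ((i, n) # t) \<longleftrightarrow> i \<in> {0, 1} \<and> in_S en a t"
  by (subst in_S.simps) auto

lemma in_S_limit_Cons_iff: "is_limit a \<Longrightarrow> in_S en a ((i, n) # t) \<longleftrightarrow> i = 0 \<and> in_S en (en a n) t"
  by (subst in_S.simps) auto

lemma typeB_root: "typeB (S_set en (osucc a)) []"
  unfolding typeB_def successors_def S_set_def
  by (auto simp: in_S_osucc_Cons_iff in_S.empty)

lemma typeC_root: "is_limit a \<Longrightarrow> typeC (S_set en a) []"
  unfolding typeC_def successors_def S_set_def
  by (auto simp: in_S_limit_Cons_iff in_S.empty)

text \<open>The types of nodes are defined through the successor sets, which correspond under prefixing by \<open>p\<close>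
  when the set of nodes above \<open>p\<close> is a copy of \<open>S\<^sub>b\<close>.  Both kinds of ordinals in the recursion for
  \<open>S\<^sub>\<alpha>\<close> are covered in this way.\<close>

lemma sprawling_tree_subtree:
  assumes x: "sprawling_tree en \<delta> a x"
    and sub: "\<And>t. p # t \<in> S_set en a \<longleftrightarrow> t \<in> S_set en b"
  shows "sprawling_tree en \<delta> b (\<lambda>t. x (p # t))"
proof -
  have succ: "successors (S_set en a) (p # s) = (#) p ` successors (S_set en b) s" for s
    unfolding successors_def using sub by (auto simp: image_iff)
  have inj: "(#) p ` A = (#) p ` B \<longleftrightarrow> A = B" for A B :: "(nat \<times> nat) list set"
    by (rule inj_image_eq_iff) simp
  have "typeB (S_set en a) (p # s) \<longleftrightarrow> typeB (S_set en b) s" for s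
    unfolding typeB_def succ by (subst inj[symmetric]) (simp add: image_Un image_image)
  moreover have "typeC (S_set en a) (p # s) \<longleftrightarrow> typeC (S_set en b) s" for s
    unfolding typeC_def succ by (subst inj[symmetric]) (simp add: image_image)
  ultimately show ?thesis
    unfolding sprawling_tree_def
    using x[unfolded sprawling_tree_def, rule_format, of "p # _"] sub by simp
qed

text \<open>The set \<open>K\<close> is fixed and the induction runs over the height for all trees in \<open>K\<close>, so the hypothesis
  puts each node of length one in the corresponding \<open>\<gamma>\<^sup>\<beta>(K)\<close>.  Boundedness of \<open>K\<close> enters through
  the choice of a weakly small difference of two of these nodes.\<close>

lemma sprawling_tree_root_in_gamma:
  assumes en: "limit_enumeration en" and K: "convex K" "bounded K"
    and "a < omega1" "sprawling_tree en \<delta> a x" "x ` S_set en a \<subseteq> K"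
  shows "x [] \<in> gamma \<delta> a K"
  using assms(4-)
proof (induction a arbitrary: x rule: less_induct)
  case (less a)
  have node: "x s \<in> K" if "in_S en a s" for s
    using less.prems(3) that by (auto simp: S_set_def)
  have child: "x [p] \<in> gamma \<delta> b K"
    if "b < a" and sub: "\<And>t. p # t \<in> S_set en a \<longleftrightarrow> t \<in> S_set en b" for b p
  proof (rule less.IH[of b "\<lambda>t. x (p # t)"])
    show "sprawling_tree en \<delta> b (\<lambda>t. x (p # t))"
      using less.prems(2) sub by (rule sprawling_tree_subtree)
    show "(\<lambda>t. x (p # t)) ` S_set en b \<subseteq> K"
      using less.prems(3) sub by auto
  qed (use \<open>b < a\<close> \<open>a < omega1\<close> in auto)
  have root: "[] \<in> S_set en a" by (simp add: S_set_def in_S.empty)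
  show ?case
  proof (cases a rule: ordinal_cases)
    case zero
    then show ?thesis using node[OF in_S.empty] by (simp add: gamma_zero)
  next
    case (osucc b)
    have children: "x [(i, n)] \<in> gamma \<delta> b K" if "i \<in> {0, 1}" for i n
      using that osucc by (intro child) (auto simp: S_set_def in_S_osucc_Cons_iff)
    have in_K: "range (\<lambda>n. x [(0, n)]) \<subseteq> K"
      using osucc node by (auto simp: in_S_osucc_Cons_iff in_S.empty)
    have "typeB (S_set en a) []" using typeB_root osucc by simp
    then have "x [] = (1/2) *\<^sub>R (x [(0, n)] + x [(1, n)])"
        "n \<noteq> m \<Longrightarrow> norm (x [(0, n)] - x [(0, m)]) \<ge> \<delta>" for n m
      using less.prems(2) root unfolding sprawling_tree_def by fastforce+
    then have "x [] \<in> sigma1 \<delta> (gamma \<delta> b K)"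
      using children
      by (intro sprawling_midpoint_in_sigma1[OF convex_gamma[OF K(1)], where y = "\<lambda>n. x [(0, n)]" and z = "\<lambda>n. x [(1, n)]"]
          bounded_subset[OF K(2) in_K]) auto
    then show ?thesis
      using sigma1_subset_gamma1 osucc by (auto simp: gamma_osucc)
  next
    case limit
    have range: "range (en a) = {..<a}"
      using en limit \<open>a < omega1\<close> by (simp add: limit_enumeration_def)
    have "typeC (S_set en a) []" using limit by (rule typeC_root)
    then have eq: "x [] = x [(0, n)]" for n
      using less.prems(2) root unfolding sprawling_tree_def by fastforce
    have "x [] \<in> gamma \<delta> (en a n) K" for n
      unfolding eq[of n] using range limit
      by (intro child) (auto simp: S_set_def in_S_limit_Cons_iff)
    then show ?thesis
      using limit range by (auto simp: gamma_limit image_iff set_eq_iff) metis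
  qed
qed

section \<open>Comparison of the indices\<close>

lemma gamma_nonempty_if_less_ST_at:
  fixes en :: "'a::banach ordinal \<Rightarrow> nat \<Rightarrow> 'a ordinal"
  assumes "limit_enumeration en" and "a < omega1" and "Ord a < ST_at en \<delta>"
  shows "gamma \<delta> a (cball 0 1 :: 'a set) \<noteq> {}"
proof -
  have "contains_sprawling_tree en \<delta> a (cball 0 1)"
  proof (rule ccontr)
    assume "\<not> ?thesis"
    then have "ST_at en \<delta> \<le> Ord a"
      unfolding ST_at_def using \<open>a < omega1\<close> by (intro Inf_lower) auto
    then show False using assms(3) by simp
  qed
  then show ?thesis
    unfolding contains_sprawling_tree_def
    using sprawling_tree_root_in_gamma[OF assms(1) convex_cball bounded_cball assms(2)] by blast
qed

lemma C_at_eq_OrdD: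
  assumes "C_at \<epsilon> = Ord (c :: 'a::banach ordinal)"
  shows "gamma \<epsilon> c (cball 0 1 :: 'a set) = {}"
  using assms LeastI_ex[of "\<lambda>a. gamma \<epsilon> a (cball 0 1 :: 'a set) = {}"]
  by (auto simp: C_at_def Inf_index_def split: if_splits)

theorem proposition3p10:
  fixes en :: "'a::banach ordinal \<Rightarrow> nat \<Rightarrow> 'a ordinal"
  assumes "separable_space (euclidean :: 'a topology)"
    and "limit_enumeration en"
  shows "ST_index en \<le> (C_index :: 'a ordinal index) \<and>
         (\<forall>\<delta>>0. \<forall>\<alpha><omega1. ST_at en \<delta> > Ord \<alpha> \<longrightarrow> (C_at \<delta> :: 'a ordinal index) > Ord \<alpha>)"
proof (intro conjI allI impI)
  have "ST_at en \<delta> \<le> (C_at \<delta> :: 'a ordinal index)" for \<delta>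
  proof (rule ccontr)
    assume "\<not> ?thesis"
    then have less: "C_at \<delta> < ST_at en \<delta>" by simp
    then obtain c :: "'a ordinal" where c: "C_at \<delta> = Ord c"
      by (cases "C_at \<delta> :: 'a ordinal index") (auto simp: less_index_def)
    have below: "gamma \<delta> b (cball 0 1 :: 'a set) \<noteq> {}" if "b < omega1" "b \<le> c" for b
      using that less c
      by (intro gamma_nonempty_if_less_ST_at[OF assms(2)]) (auto intro: le_less_trans[of _ "Ord c"])
    have "gamma \<delta> c (cball 0 1 :: 'a set) \<noteq> {}"
    proof (cases "c < omega1")
      case False
      \<comment> \<open>The least vanishing stage cannot be uncountable: if no countable stage is empty, none is.\<close>
      then have "gamma \<delta> b (cball 0 1 :: 'a set) \<noteq> {}" if "b < omega1" for b
        using that by (intro below) auto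
      then show ?thesis
        by (rule gamma_nonempty_if_nonempty_below_omega1[OF assms(1) closed_cball convex_cball])
    qed (rule below, simp_all)
    then show False using C_at_eq_OrdD[OF c] by blast
  qed
  note ST_le_C = this
  show "ST_index en \<le> (C_index :: 'a ordinal index)"
    unfolding ST_index_def C_index_def by (intro SUP_mono) (use ST_le_C in blast)
  show "Ord \<alpha> < (C_at \<delta> :: 'a ordinal index)" if "Ord \<alpha> < ST_at en \<delta>" for \<delta> \<alpha>
    using that ST_le_C by (rule less_le_trans)
qed

end
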